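(* Let $A$ be a linear relation in a linear space $\mathfrak{H}$ over $\mathbb{C}$. Assume that there exists $k\in\mathbb{N}$ such that $\lambda_1,\ldots,\lambda_k\in\sigma_\pi(A)$ are pairwise distinct proper eigenvalues of $A$, and let $$x_i\in\mathfrak{R}_{\lambda_i}(A)\setminus\mathfrak{R}_c(A),\quad i=1,\ldots,k.$$ Then the elements $x_1,\ldots,x_k$ are linearly independent in $\mathfrak{H}$.
   Context: Let $\mathfrak{H}$ be a (possibly infinite-dimensional) linear space over $\mathbb{C}$. A linear relation $A$ in $\mathfrak{H}$ is a linear subspace of $\mathfrak{H}\times\mathfrak{H}$. Put $\ker A=\{x: (x,0)\in A\}$, $\operatorname{mul}A=\{y:(0,y)\in A\}$. For $\lambda\in\mathbb{C}$, $A-\lambda=\{(x,y-\lambda x):(x,y)\in A\}$. The product of linear relations is $AB=\{(x,y): \exists z\in\mathfrak{H},\ (x,z)\in B,\ (z,y)\in A\}$, and $A^k=AA^{k-1}$ for $k\ge1$ with $A^0=I$. The root spaces are the linear subspaces $$\mathfrak{R}_\lambda(A)=\bigcup_{i=1}^\infty\ker(A-\lambda)^i\ (\lambda\in\mathbb{C}),\qquad \mathfrak{R}_\infty(A)=\bigcup_{i=1}^\infty\operatorname{mul}A^i,$$ and the singular chain space is $\mathfrak{R}_c(A)=\mathfrak{R}_0(A)\cap\mathfrak{R}_\infty(A)$. The proper point spectrum $\sigma_\pi(A)$ is the set of all $\lambda\in\mathbb{C}\cup\{\infty\}$ with $\mathfrak{R}_\lambda(A)\setminus\mathfrak{R}_c(A)\neq\emptyset$;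 its elements are called the proper eigenvalues of $A$. *)

theory Defs
  imports "HOL-Analysis.Product_Vector"
begin

(* The linear space is a type 'a with an arbitrary complex scalar multiplication
   smul, subject to vector_space smul; it may be infinite-dimensional. *)

definition linear_relation ::
    "(complex \<Rightarrow> 'a::ab_group_add \<Rightarrow> 'a) \<Rightarrow> ('a \<times> 'a) set \<Rightarrow> bool"
  where "linear_relation smul A \<longleftrightarrow> module.subspace (module_prod.scale smul smul) A"

definition rel_ker :: "('a::zero \<times> 'a) set \<Rightarrow> 'a set"
  where "rel_ker A = {x. (x, 0) \<in> A}"

definition rel_mul :: "('a::zero \<times> 'a) set \<Rightarrow> 'a set"
  where "rel_mul A = {y. (0, y) \<in> A}"

definition rel_shift ::
    "(complex \<Rightarrow> 'a::ab_group_add \<Rightarrow> 'a) \<Rightarrow> ('a \<times> 'a) set \<Rightarrow> complex \<Rightarrow> ('a \<times> 'a) set"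
  where "rel_shift smul A l = {(x, y - smul l x) | x y. (x, y) \<in> A}"

(* The extended complex plane; the library type extended would add two infinities. *)
datatype ecomplex = Fin complex | Infty

(* The product AB of linear relations (first B, then A) is B O A in the library's
   order of composition, so A A^(k-1) is (A ^^ (k-1)) O A, and the k-th power of A
   is A ^^ k. *)
fun root_space ::
    "(complex \<Rightarrow> 'a::ab_group_add \<Rightarrow> 'a) \<Rightarrow> ('a \<times> 'a) set \<Rightarrow> ecomplex \<Rightarrow> 'a set"
  where
    "root_space smul A (Fin l) = (\<Union>i\<in>{1::nat..}. rel_ker (rel_shift smul A l ^^ i))"
  | "root_space smul A Infty = (\<Union>i\<in>{1::nat..}. rel_mul (A ^^ i))"

definition singular_chain_space ::
    "(complex \<Rightarrow> 'a::ab_group_add \<Rightarrow> 'a) \<Rightarrow> ('a \<times> 'a) set \<Rightarrow> 'a set"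
  where "singular_chain_space smul A = root_space smul A (Fin 0) \<inter> root_space smul A Infty"

definition proper_point_spectrum ::
    "(complex \<Rightarrow> 'a::ab_group_add \<Rightarrow> 'a) \<Rightarrow> ('a \<times> 'a) set \<Rightarrow> ecomplex set"
  where "proper_point_spectrum smul A =
    {l. root_space smul A l - singular_chain_space smul A \<noteq> {}}"

(* Linear independence of a family: module.dependent speaks about sets, so a
   repeated element has to be excluded separately. *)
definition independent_family ::
    "(complex \<Rightarrow> 'a::ab_group_add \<Rightarrow> 'a) \<Rightarrow> 'i set \<Rightarrow> ('i \<Rightarrow> 'a) \<Rightarrow> bool"
  where "independent_family smul I x \<longleftrightarrow> inj_on x I \<and> \<not> module.dependent smul (x ` I)"

end

theory Submission
  imports Defs
begin

text \<open>
  The theorem follows from a statement about sums: if \<open>y\<^sub>1, \<dots>, y\<^sub>k\<close> lie in root spaces for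
  pairwise distinct points of the extended plane and add up to \<open>0\<close>, then every \<open>y\<^sub>i\<close> lies in the
  singular chain space \<open>\<RR>\<^sub>c\<close>. Applied to \<open>y\<^sub>i = c\<^sub>i x\<^sub>i\<close>, it forces \<open>c\<^sub>i = 0\<close>, because \<open>\<RR>\<^sub>c\<close> is a
  subspace that does not contain \<open>x\<^sub>i\<close>.

  Write \<open>\<RR>\<^sub>\<lambda>\<close> for the root spaces and \<open>M = \<RR>\<^sub>\<infinity>\<close>. The multivalued part of \<open>A\<close> is contained in \<open>M\<close>,
  and \<open>A\<close> maps \<open>M\<close> into \<open>M\<close>, so modulo \<open>M\<close> the relation \<open>A\<close> becomes a single-valued partial
  operator. The image of \<open>\<RR>\<^sub>\<lambda>\<close> consists of generalised eigenvectors of this operator, so the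
  classical independence of root vectors shows that a sum of elements of root spaces for distinct
  finite \<open>\<lambda>\<close> is in \<open>M\<close> only if each summand is (\<open>summand_in_root_Infty\<close>). The proof below works
  with representatives and avoids the quotient space.

  It remains to see that \<open>\<RR>\<^sub>\<lambda> \<inter> M \<subseteq> \<RR>\<^sub>0\<close> (\<open>root_Fin_Int_root_Infty\<close>). This is a
  controllability argument: a vector \<open>y\<close> of this intersection is sent by \<open>A\<^sup>N\<close> to \<open>\<lambda>\<^sup>N y\<close> up to an
  element of \<open>\<RR>\<^sub>0\<close>, while for large \<open>N\<close> the vector \<open>\<lambda>\<^sup>N y\<close> is reached from \<open>0\<close> by \<open>A\<^sup>N\<close> and can be
  subtracted. The summand for the eigenvalue \<open>\<infinity>\<close>, if there is one, is minus the sum of the others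
  and hence also in \<open>\<RR>\<^sub>0\<close>.
\<close>

declare root_space.simps [simp del]

lemma linear_relation_iff:
  assumes "vector_space smul"
  shows "linear_relation smul A \<longleftrightarrow> (0, 0) \<in> A
    \<and> (\<forall>x y x' y'. (x, y) \<in> A \<longrightarrow> (x', y') \<in> A \<longrightarrow> (x + x', y + y') \<in> A)
    \<and> (\<forall>c x y. (x, y) \<in> A \<longrightarrow> (smul c x, smul c y) \<in> A)"
proof -
  interpret vector_space smul by fact
  interpret P: module_prod smul smul by unfold_locales
  show ?thesis
    unfolding linear_relation_def P.p.subspace_def P.scale_def
    by (simp add: zero_prod_def Ball_def)
qed

lemma independent_familyI:
  assumes "vector_space smul" and "finite I"
    and coeffs: "\<And>c i. (\<Sum>i\<in>I. smul (c i) (x i)) = 0 \<Longrightarrow> i \<in> I \<Longrightarrow> c i = 0"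
  shows "independent_family smul I x"
proof -
  interpret vector_space smul by fact
  have inj: "inj_on x I"
  proof (rule inj_onI, rule ccontr)
    fix i j assume ij: "i \<in> I" "j \<in> I" "x i = x j" "i \<noteq> j"
    define c :: "_ \<Rightarrow> complex" where "c = (\<lambda>_. 0)(i := 1, j := -1)"
    have "(\<Sum>n\<in>I. smul (c n) (x n)) = (\<Sum>n\<in>{i, j}. smul (c n) (x n))"
      using ij \<open>finite I\<close> by (intro sum.mono_neutral_right) (auto simp: c_def)
    also have "\<dots> = 0"
      using ij by (simp add: c_def)
    finally have "c i = 0"
      using coeffs ij by blast
    then show False
      using ij by (simp add: c_def)
  qed
  have "\<not> dependent (x ` I)"
  proof
    assume "dependent (x ` I)"
    then obtain u v where uv: "v \<in> x ` I" "u v \<noteq> 0" "(\<Sum>v\<in>x ` I. smul (u v) v) = 0"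
      using dependent_finite \<open>finite I\<close> by auto
    then have "(\<Sum>i\<in>I. smul (u (x i)) (x i)) = 0"
      by (simp add: sum.reindex[OF inj])
    with uv coeffs[of "\<lambda>i. u (x i)"] show False by auto
  qed
  with inj show ?thesis
    by (simp add: independent_family_def)
qed

section \<open>Root spaces of a linear relation\<close>

locale linear_rel = vector_space smul
  for smul :: "complex \<Rightarrow> 'a::ab_group_add \<Rightarrow> 'a" (infixr "*s" 75) +
  fixes A :: "('a \<times> 'a) set"
  assumes linear_relation: "linear_relation smul A"
begin

lemma rel_zero: "(0, 0) \<in> A"
  and rel_add: "(x, y) \<in> A \<Longrightarrow> (x', y') \<in> A \<Longrightarrow> (x + x', y + y') \<in> A"
  and rel_scale: "(x, y) \<in> A \<Longrightarrow> (c *s x, c *s y) \<in> A"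
  using linear_relation unfolding linear_relation_iff[OF vector_space_axioms] by blast+

lemma rel_diff: "(x, y) \<in> A \<Longrightarrow> (x', y') \<in> A \<Longrightarrow> (x - x', y - y') \<in> A"
  using rel_add[of x y "- x'" "- y'"] rel_scale[of x' y' "-1"] by simp

lemma linear_relI:
  assumes "(0, 0) \<in> B"
    and "\<And>x y x' y'. (x, y) \<in> B \<Longrightarrow> (x', y') \<in> B \<Longrightarrow> (x + x', y + y') \<in> B"
    and "\<And>c x y. (x, y) \<in> B \<Longrightarrow> (c *s x, c *s y) \<in> B"
  shows "linear_rel smul B"
  using assms
  by (intro linear_rel.intro linear_rel_axioms.intro vector_space_axioms)
    (simp add: linear_relation_iff[OF vector_space_axioms])

lemma linear_rel_power: "linear_rel smul (A ^^ n)"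
proof (induction n)
  case 0
  show ?case
    by (rule linear_relI) auto
next
  case (Suc n)
  then interpret P: linear_rel smul "A ^^ n" .
  show ?case
  proof (rule linear_relI)
    show "(0, 0) \<in> A ^^ Suc n"
      using P.rel_zero rel_zero by (rule relpow_Suc_I)
  next
    fix x y x' y' assume "(x, y) \<in> A ^^ Suc n" "(x', y') \<in> A ^^ Suc n"
    then show "(x + x', y + y') \<in> A ^^ Suc n"
      by (elim relpow_Suc_E) (rule relpow_Suc_I[OF P.rel_add rel_add])
  next
    fix c x y assume "(x, y) \<in> A ^^ Suc n"
    then show "(c *s x, c *s y) \<in> A ^^ Suc n"
      by (elim relpow_Suc_E) (rule relpow_Suc_I[OF P.rel_scale rel_scale])
  qed
qed

lemma mem_rel_shift: "(x, y) \<in> rel_shift smul A a \<longleftrightarrow> (x, y + a *s x) \<in> A"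
  unfolding rel_shift_def by (auto intro: exI[of _ "y + a *s x"])

lemma linear_rel_shift: "linear_rel smul (rel_shift smul A a)"
proof (rule linear_relI; unfold mem_rel_shift)
  show "(0, 0 + a *s 0) \<in> A"
    using rel_zero by simp
next
  fix x y x' y' assume "(x, y + a *s x) \<in> A" "(x', y' + a *s x') \<in> A"
  from rel_add[OF this] show "(x + x', y + y' + a *s (x + x')) \<in> A"
    by (simp add: algebra_simps)
next
  fix c x y assume "(x, y + a *s x) \<in> A"
  from rel_scale[OF this, of c] show "(c *s x, c *s y + a *s (c *s x)) \<in> A"
    by (simp add: scale_right_distrib mult.commute)
qed

abbreviation root :: "ecomplex \<Rightarrow> 'a set"
  where "root \<equiv> root_space smul A"

text \<open>The zeroth power may be admitted in the definition of the root spaces, since it only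
  contributes the vector \<open>0\<close>. This makes induction on the chain length start at a trivial case.\<close>

lemma mem_root_Fin: "x \<in> root (Fin a) \<longleftrightarrow> (\<exists>n. (x, 0) \<in> rel_shift smul A a ^^ n)"
proof -
  interpret S: linear_rel smul "rel_shift smul A a" by (rule linear_rel_shift)
  have "\<exists>m\<ge>Suc 0. (x, 0) \<in> rel_shift smul A a ^^ m" if "(x, 0) \<in> rel_shift smul A a ^^ n" for n
    using relpow_Suc_I[OF that S.rel_zero] by (intro exI[of _ "Suc n"]) simp
  then show ?thesis
    by (auto simp: root_space.simps rel_ker_def)
qed

lemma mem_root_Infty: "x \<in> root Infty \<longleftrightarrow> (\<exists>n. (0, x) \<in> A ^^ n)"
proof -
  have "\<exists>m\<ge>Suc 0. (0, x) \<in> A ^^ m" if "(0, x) \<in> A ^^ n" for n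
    using relpow_Suc_I2[OF rel_zero that] by (intro exI[of _ "Suc n"]) simp
  then show ?thesis
    by (auto simp: root_space.simps rel_mul_def)
qed

lemma power_zero_left_mono: "m \<le> n \<Longrightarrow> (0, x) \<in> A ^^ m \<Longrightarrow> (0, x) \<in> A ^^ n"
  by (induction rule: dec_induct) (auto intro: relpow_Suc_I2 rel_zero simp del: relpow.simps)

lemma power_zero_right_mono: "m \<le> n \<Longrightarrow> (x, 0) \<in> A ^^ m \<Longrightarrow> (x, 0) \<in> A ^^ n"
  by (induction rule: dec_induct) (auto intro: relpow_Suc_I rel_zero simp del: relpow.simps)

lemma subspace_root: "subspace (root e)"
proof (cases e)
  case (Fin a)
  interpret S: linear_rel smul "rel_shift smul A a" by (rule linear_rel_shift)
  show ?thesis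
  proof (rule subspaceI; unfold Fin mem_root_Fin)
    show "\<exists>n. (0, 0) \<in> rel_shift smul A a ^^ n"
      by (intro exI[of _ 0]) simp
  next
    fix x y assume "\<exists>n. (x, 0) \<in> rel_shift smul A a ^^ n" "\<exists>n. (y, 0) \<in> rel_shift smul A a ^^ n"
    then obtain m n where mn: "(x, 0) \<in> rel_shift smul A a ^^ m" "(y, 0) \<in> rel_shift smul A a ^^ n"
      by blast
    interpret P: linear_rel smul "rel_shift smul A a ^^ max m n" by (rule S.linear_rel_power)
    show "\<exists>n. (x + y, 0) \<in> rel_shift smul A a ^^ n"
      using P.rel_add[of x 0 y 0] S.power_zero_right_mono[OF _ mn(1), of "max m n"]
        S.power_zero_right_mono[OF _ mn(2), of "max m n"] by auto
  next
    fix c x assume "\<exists>n. (x, 0) \<in> rel_shift smul A a ^^ n"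
    then obtain n where n: "(x, 0) \<in> rel_shift smul A a ^^ n" ..
    interpret P: linear_rel smul "rel_shift smul A a ^^ n" by (rule S.linear_rel_power)
    show "\<exists>n. (c *s x, 0) \<in> rel_shift smul A a ^^ n"
      using P.rel_scale[OF n, of c] by auto
  qed
next
  case Infty
  show ?thesis
  proof (rule subspaceI; unfold Infty mem_root_Infty)
    show "\<exists>n. (0, 0) \<in> A ^^ n"
      by (intro exI[of _ 0]) simp
  next
    fix x y assume "\<exists>n. (0, x) \<in> A ^^ n" "\<exists>n. (0, y) \<in> A ^^ n"
    then obtain m n where mn: "(0, x) \<in> A ^^ m" "(0, y) \<in> A ^^ n"
      by blast
    interpret P: linear_rel smul "A ^^ max m n" by (rule linear_rel_power)
    show "\<exists>n. (0, x + y) \<in> A ^^ n"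
      using P.rel_add[of 0 x 0 y] power_zero_left_mono[OF _ mn(1), of "max m n"]
        power_zero_left_mono[OF _ mn(2), of "max m n"] by auto
  next
    fix c x assume "\<exists>n. (0, x) \<in> A ^^ n"
    then obtain n where n: "(0, x) \<in> A ^^ n" ..
    interpret P: linear_rel smul "A ^^ n" by (rule linear_rel_power)
    show "\<exists>n. (0, c *s x) \<in> A ^^ n"
      using P.rel_scale[OF n, of c] by auto
  qed
qed

lemmas root_zero [simp] = subspace_0[OF subspace_root]
lemmas root_add = subspace_add[OF subspace_root]
lemmas root_diff = subspace_diff[OF subspace_root]
lemmas root_scale = subspace_scale[OF subspace_root]
lemmas root_sum = subspace_sum[OF subspace_root]

lemma root_scale_iff: "c \<noteq> 0 \<Longrightarrow> c *s x \<in> root e \<longleftrightarrow> x \<in> root e"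
  using root_scale[of "c *s x" e "inverse c"] root_scale[of x e c] by auto

lemma root_add_cancel: "x \<in> root e \<Longrightarrow> x + y \<in> root e \<longleftrightarrow> y \<in> root e"
  using root_add[of x e y] root_diff[of "x + y" e x] by auto

text \<open>This is the only way in which elements of \<open>\<RR>\<^sub>\<lambda>\<close> are taken apart below: the link
  \<open>(x, y) \<in> A - \<lambda>\<close> of a chain is expressed by \<open>(x, y + \<lambda>x) \<in> A\<close>, and the induction is on
  the length of the chain.\<close>

lemma root_Fin_induct [consumes 1, case_names zero step]:
  assumes "x \<in> root (Fin a)"
    and zero: "P 0"
    and step: "\<And>x y. (x, y + a *s x) \<in> A \<Longrightarrow> y \<in> root (Fin a) \<Longrightarrow> P y \<Longrightarrow> P x"
  shows "P x"
proof -
  obtain n where "(x, 0) \<in> rel_shift smul A a ^^ n"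
    using assms(1) mem_root_Fin by blast
  then show ?thesis
  proof (induction n arbitrary: x)
    case 0
    then show ?case using zero by simp
  next
    case (Suc n)
    then obtain y where "(x, y) \<in> rel_shift smul A a" "(y, 0) \<in> rel_shift smul A a ^^ n"
      by (blast elim: relpow_Suc_E2)
    with Suc.IH show ?case
      using step[of x y] mem_root_Fin by (auto simp: mem_rel_shift)
  qed
qed

lemma root_Fin_link:
  assumes "x \<in> root (Fin a)"
  obtains y where "(x, y + a *s x) \<in> A" "y \<in> root (Fin a)"
  using assms
proof (induction arbitrary: thesis rule: root_Fin_induct)
  case zero
  show ?case
    by (rule zero[of 0]) (use rel_zero in auto)
next
  case (step x y)
  from step.prems[OF step.hyps(1,2)] show ?case .
qed

text \<open>Since \<open>A - \<mu> = (A - \<lambda>) + (\<lambda> - \<mu>)\<close>, each \<open>\<RR>\<^sub>\<lambda>\<close> offers links for all shifts of \<open>A\<close>.\<close>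

lemma root_Fin_shifted_link:
  assumes "x \<in> root (Fin a)"
  obtains y where "(x, y + b *s x) \<in> A" "y \<in> root (Fin a)"
proof -
  obtain z where z: "(x, z + a *s x) \<in> A" "z \<in> root (Fin a)"
    using assms by (rule root_Fin_link)
  show thesis
  proof (rule that[of "z + (a - b) *s x"])
    show "(x, z + (a - b) *s x + b *s x) \<in> A"
      using z(1) by (simp add: algebra_simps)
    show "z + (a - b) *s x \<in> root (Fin a)"
      using z(2) assms by (intro root_add root_scale)
  qed
qed

lemma root_Infty_step: "x \<in> root Infty \<Longrightarrow> (x, y) \<in> A \<Longrightarrow> y \<in> root Infty"
  unfolding mem_root_Infty by (blast intro: relpow_Suc_I)

lemma root_Infty_step_shifted: "x \<in> root Infty \<Longrightarrow> (x, y + a *s x) \<in> A \<Longrightarrow> y \<in> root Infty"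
  using root_Infty_step[of x "y + a *s x"] root_add_cancel[of "a *s x" Infty y] root_scale
  by (simp add: add.commute)

lemma root_Infty_of_mul: "(0, y) \<in> A \<Longrightarrow> y \<in> root Infty"
  using root_Infty_step[OF root_zero] .

lemma root_Fin_0_backstep: "(x, y) \<in> A ^^ n \<Longrightarrow> y \<in> root (Fin 0) \<Longrightarrow> x \<in> root (Fin 0)"
proof -
  have "rel_shift smul A 0 = A"
    by (auto simp: mem_rel_shift)
  then show "(x, y) \<in> A ^^ n \<Longrightarrow> y \<in> root (Fin 0) \<Longrightarrow> x \<in> root (Fin 0)"
    unfolding mem_root_Fin by (metis relcomp.relcompI relpow_add)
qed

section \<open>Singular chains\<close>

text \<open>Suppose that \<open>(y, r + \<lambda>y) \<in> A\<close> where \<open>r\<close> is already known to lie in \<open>\<RR>\<^sub>0\<close>. As elements of \<open>\<RR>\<^sub>0\<close>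
  can be moved on inside \<open>\<RR>\<^sub>0\<close>, iterating gives \<open>(y, r' + \<lambda>\<^sup>N y) \<in> A\<^sup>N\<close> with \<open>r' \<in> \<RR>\<^sub>0\<close> for every \<open>N\<close>.
  If \<open>(0, y) \<in> A\<^sup>N\<close>, then subtracting \<open>(0, \<lambda>\<^sup>N y)\<close> leaves \<open>(y, r') \<in> A\<^sup>N\<close>.\<close>

lemma root_Fin_Int_root_Infty:
  assumes "y \<in> root (Fin a)" "y \<in> root Infty"
  shows "y \<in> root (Fin 0)"
  using assms
proof (induction rule: root_Fin_induct)
  case zero
  show ?case by simp
next
  case (step y r)
  have "r \<in> root Infty"
    using root_Infty_step_shifted step.hyps(1) step.prems by blast
  with step.IH have r: "r \<in> root (Fin 0)" .
  have iterate: "\<exists>r'\<in>root (Fin 0). (y, r' + a ^ N *s y) \<in> A ^^ N" for N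
  proof (induction N)
    case 0
    show ?case
      by (rule bexI[of _ 0]) auto
  next
    case (Suc N)
    then obtain r' where r': "r' \<in> root (Fin 0)" "(y, r' + a ^ N *s y) \<in> A ^^ N"
      by blast
    obtain r'' where r'': "(r', r'') \<in> A" "r'' \<in> root (Fin 0)"
      using root_Fin_link[OF r'(1)] by auto
    have "(r' + a ^ N *s y, r'' + a ^ N *s (r + a *s y)) \<in> A"
      using rel_add[OF r''(1) rel_scale[OF step.hyps(1)]] .
    then have "(r' + a ^ N *s y, (r'' + a ^ N *s r) + a ^ Suc N *s y) \<in> A"
      by (simp add: algebra_simps)
    then have "(y, (r'' + a ^ N *s r) + a ^ Suc N *s y) \<in> A ^^ Suc N"
      using r'(2) by (blast intro: relpow_Suc_I)
    moreover have "r'' + a ^ N *s r \<in> root (Fin 0)"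
      using r r''(2) by (intro root_add root_scale)
    ultimately show ?case by blast
  qed
  obtain N where N: "(0, y) \<in> A ^^ N"
    using step.prems mem_root_Infty by blast
  obtain r' where r': "r' \<in> root (Fin 0)" "(y, r' + a ^ N *s y) \<in> A ^^ N"
    using iterate by blast
  interpret P: linear_rel smul "A ^^ N" by (rule linear_rel_power)
  have "(y, r') \<in> A ^^ N"
    using P.rel_diff[OF r'(2) P.rel_scale[OF N, of "a ^ N"]] by simp
  then show ?case
    using r'(1) by (rule root_Fin_0_backstep)
qed

section \<open>Sums of root vectors\<close>

text \<open>Modulo \<open>\<RR>\<^sub>\<infinity>\<close> the relation \<open>A\<close> is an operator, so this says that the operator \<open>A - \<mu>\<close> is
  injective on the root space for \<open>\<lambda> \<noteq> \<mu>\<close>. With \<open>z\<close> the next element of the \<open>\<lambda>\<close>-chain of \<open>x\<close>,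
  single-valuedness gives \<open>z + (\<lambda> - \<mu>)x \<in> \<RR>\<^sub>\<infinity>\<close>. Applying \<open>A - \<lambda>\<close> yields the hypothesis for the
  shorter chain of \<open>z\<close>; hence \<open>z \<in> \<RR>\<^sub>\<infinity>\<close>, and \<open>x\<close> is a multiple of an element of \<open>\<RR>\<^sub>\<infinity>\<close>.\<close>

lemma shift_injective_mod_root_Infty:
  assumes "x \<in> root (Fin a)" "a \<noteq> b" "(x, y + b *s x) \<in> A" "y \<in> root Infty"
  shows "x \<in> root Infty"
  using assms(1,3,4)
proof (induction arbitrary: y rule: root_Fin_induct)
  case zero
  show ?case by simp
next
  case (step x z)
  have "(0, y + b *s x - (z + a *s x)) \<in> A"
    using rel_diff[OF step.prems(1) step.hyps(1)] by simp
  then have "y - (y + b *s x - (z + a *s x)) \<in> root Infty"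
    by (rule root_diff[OF step.prems(2) root_Infty_of_mul])
  then have zx: "z + (a - b) *s x \<in> root Infty"
    by (simp add: algebra_simps)
  obtain z' where z': "(z, z' + a *s z) \<in> A"
    using root_Fin_link[OF step.hyps(2)] by blast
  have "(z + (a - b) *s x, (z' + a *s z) + (a - b) *s (z + a *s x)) \<in> A"
    using rel_add[OF z' rel_scale[OF step.hyps(1)]] .
  then have "(z + (a - b) *s x, (z' + (a - b) *s z) + a *s (z + (a - b) *s x)) \<in> A"
    by (simp add: algebra_simps)
  then have "z' + (a - b) *s z \<in> root Infty"
    using zx root_Infty_step_shifted by blast
  moreover have "(z, (z' + (a - b) *s z) + b *s z) \<in> A"
    using z' by (simp add: algebra_simps)
  ultimately have "z \<in> root Infty"
    by (rule step.IH[rotated])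
  with zx have "(a - b) *s x \<in> root Infty"
    using root_add_cancel by blast
  then show ?case
    using \<open>a \<noteq> b\<close> by (simp add: root_scale_iff)
qed

lemma rel_sum:
  assumes "\<And>i. i \<in> I \<Longrightarrow> (f i, g i) \<in> A"
  shows "(sum f I, sum g I) \<in> A"
  using assms by (induction I rule: infinite_finite_induct) (auto intro: rel_zero rel_add)

text \<open>The classical argument for root vectors of an operator, modulo \<open>\<RR>\<^sub>\<infinity>\<close>: a single eigenvalue \<open>\<mu>\<close>
  is removed from the sum by applying \<open>A - \<mu>\<close> until the summand for \<open>\<mu>\<close> vanishes. Each application
  keeps the other summands in their root spaces, and by injectivity of \<open>A - \<mu>\<close> on these
  nothing is lost.\<close>

lemma summand_in_root_Infty:
  fixes a :: "'i \<Rightarrow> complex"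
  assumes "finite I" "inj_on a I" "\<And>i. i \<in> I \<Longrightarrow> y i \<in> root (Fin (a i))"
    and "sum y I \<in> root Infty" "i \<in> I"
  shows "y i \<in> root Infty"
proof -
  have "\<forall>i\<in>I. y i \<in> root Infty"
    using assms(1-4)
  proof (induction I arbitrary: y rule: finite_induct)
    case empty
    show ?case by simp
  next
    case (insert j I)
    note j = \<open>finite I\<close> \<open>j \<notin> I\<close>
    have "\<forall>i\<in>I. y i \<in> root Infty"
      if "u \<in> root (Fin (a j))" "\<And>i. i \<in> I \<Longrightarrow> y i \<in> root (Fin (a i))"
        "u + sum y I \<in> root Infty" for u y
      using that
    proof (induction arbitrary: y rule: root_Fin_induct)
      case zero
      then show ?case
        using insert.IH insert.prems(1) by simp
    next
      case (step u v)
      have "\<exists>z. (y i, z + a j *s y i) \<in> A \<and> z \<in> root (Fin (a i))" if "i \<in> I" for i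
        using root_Fin_shifted_link[OF step.prems(1)[OF that]] by blast
      then obtain z where z:
        "\<And>i. i \<in> I \<Longrightarrow> (y i, z i + a j *s y i) \<in> A" "\<And>i. i \<in> I \<Longrightarrow> z i \<in> root (Fin (a i))"
        by metis
      have "(u + sum y I, (v + a j *s u) + (\<Sum>i\<in>I. z i + a j *s y i)) \<in> A"
        using rel_add[OF step.hyps(1) rel_sum[OF z(1)]] .
      then have "(u + sum y I, (v + sum z I) + a j *s (u + sum y I)) \<in> A"
        by (simp add: sum.distrib scale_sum_right algebra_simps)
      then have "v + sum z I \<in> root Infty"
        using step.prems(2) root_Infty_step_shifted by blast
      then have "\<forall>i\<in>I. z i \<in> root Infty"
        using step.IH z(2) by blast
      moreover have "a i \<noteq> a j" if "i \<in> I" for i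
        using inj_onD[OF insert.prems(1), of i j] j that by blast
      ultimately show ?case
        using shift_injective_mod_root_Infty step.prems(1) z(1) by blast
    qed
    from this[of "y j" y] have I: "\<forall>i\<in>I. y i \<in> root Infty"
      using insert.prems(2,3) j by simp
    then have "sum y I \<in> root Infty"
      by (intro root_sum) blast
    then have "y j \<in> root Infty"
      using insert.prems(3) j root_add_cancel[of "sum y I" Infty "y j"] by (simp add: add.commute)
    with I show ?case by simp
  qed
  with \<open>i \<in> I\<close> show ?thesis by blast
qed

lemma summand_in_singular_chain_space:
  assumes "finite I" "inj_on l I" and y: "\<And>i. i \<in> I \<Longrightarrow> y i \<in> root (l i)"
    and sum: "sum y I = 0" and "i \<in> I"
  shows "y i \<in> singular_chain_space smul A"
proof -
  define J where "J = {i\<in>I. l i \<noteq> Infty}"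
  have J: "finite J" "J \<subseteq> I"
    using \<open>finite I\<close> by (auto simp: J_def)
  obtain a where a: "\<And>i. i \<in> J \<Longrightarrow> l i = Fin (a i)"
  proof
    show "l i = Fin (case l i of Fin b \<Rightarrow> b | Infty \<Rightarrow> 0)" if "i \<in> J" for i
      using that by (auto simp: J_def split: ecomplex.split)
  qed
  have inj: "inj_on a J"
    using \<open>inj_on l I\<close> J(2) a by (metis inj_on_def subsetD)
  have yJ: "y i \<in> root (Fin (a i))" if "i \<in> J" for i
    using y[of i] a[OF that] that J(2) by auto
  have yInf: "y i \<in> root Infty" if "i \<in> I - J" for i
    using y[of i] that by (auto simp: J_def)
  have split: "sum y (I - J) + sum y J = 0"
    using sum.subset_diff[OF J(2) \<open>finite I\<close>, of y] sum by simp
  have "sum y (I - J) \<in> root Infty"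
    using yInf by (rule root_sum)
  then have "sum y J \<in> root Infty"
    using split root_add_cancel[of "sum y (I - J)" Infty "sum y J"] by simp
  then have J_Infty: "y i \<in> root Infty" if "i \<in> J" for i
    using summand_in_root_Infty[OF J(1) inj yJ _ that] by blast
  then have J_0: "y i \<in> root (Fin 0)" if "i \<in> J" for i
    using root_Fin_Int_root_Infty yJ that by blast
  show ?thesis
    \<comment> \<open>An index outside \<open>J\<close> is the only one, so its summand is minus the sum over \<open>J\<close>.\<close>
  proof (cases "i \<in> J")
    case True
    then show ?thesis
      using J_Infty J_0 by (simp add: singular_chain_space_def)
  next
    case False
    then have "m = i" if "m \<in> I - J" for m
      using inj_onD[OF \<open>inj_on l I\<close>, of m i] \<open>i \<in> I\<close> that by (simp add: J_def)
    with False have "I - J = {i}"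
      using \<open>i \<in> I\<close> by blast
    moreover have "sum y J \<in> root (Fin 0)"
      using J_0 by (rule root_sum)
    ultimately have "y i \<in> root (Fin 0)"
      using split root_add_cancel[of "sum y J" "Fin 0" "y i"]
      by (simp add: add.commute)
    then show ?thesis
      using yInf False \<open>i \<in> I\<close> by (simp add: singular_chain_space_def)
  qed
qed

end

theorem theorem5p2:
  fixes smul :: "complex \<Rightarrow> 'a::ab_group_add \<Rightarrow> 'a"
    and A :: "('a \<times> 'a) set"
    and k :: nat
    and l :: "nat \<Rightarrow> ecomplex"
    and x :: "nat \<Rightarrow> 'a"
  assumes "vector_space smul"
    and "linear_relation smul A"
    and "\<And>i. i \<in> {1..k} \<Longrightarrow> l i \<in> proper_point_spectrum smul A"
    and "inj_on l {1..k}"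
    and "\<And>i. i \<in> {1..k} \<Longrightarrow> x i \<in> root_space smul A (l i) - singular_chain_space smul A"
  shows "independent_family smul {1..k} x"
proof -
  interpret linear_rel smul A
    by (intro linear_rel.intro linear_rel_axioms.intro assms)
  show ?thesis
  proof (rule independent_familyI)
    fix c i assume sum: "(\<Sum>i\<in>{1..k}. smul (c i) (x i)) = 0" and i: "i \<in> {1..k}"
    have "smul (c i) (x i) \<in> singular_chain_space smul A"
      using assms(5) sum i
      by (intro summand_in_singular_chain_space[OF _ assms(4), where y = "\<lambda>i. smul (c i) (x i)"]
          root_scale) auto
    then show "c i = 0"
      using assms(5)[OF i] root_scale_iff[of "c i" "x i"]
      by (auto simp: singular_chain_space_def)
  qed (use assms in auto)
qed

end
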